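(* Let $A$ be any envy-free pricing mechanism. Then the best response dynamic of $A$ starting from truth-telling has the property that the pure Nash equilibrium reached, compared to the truth-telling state, is such that: (i) the (additive) loss in social welfare (compared to the maximum possible) is at most the maximum budget $\max_{i\in N}B_i$; (ii) the revenue is approximated within a (multiplicative) factor of at least $(\beta-\alpha)/2$, where $\beta\in[0,1]$ is the approximation ratio of mechanism $A$ for the optimal revenue and $\alpha$ is the budget share of the market.
   Context: Market: a linear multi-unit market $\mathcal{M}=(\mathbf{v},\mathbf{B},m)$ has buyers $N=\{1,\dots,n\}$ and one seller with $m$ indivisible identical units. Buyer $i$ has budget $B_i>0$ and per-unit valuation $v_i$. The utility of buyer $i$ for $k$ units at unit price $p$ is $u_i(p,k)=v_ik-pk$ if $pk\le B_i$ and $-\infty$ otherwise. The demand set $D_i(p)$ is $\{\min\{\lfloor B_i/p\rfloor,m\}\}$ if $v_i>p$; $\{0,1,\dots,\min\{\lfloor B_i/p\rfloor,m\}\}$ if $v_i=p$; and $\{0\}$ if $v_i<p$. An outcome $(\mathbf{x},p)$ with $x_i\in\mathbb{Z}_{\ge 0}$ and $\sum_i x_i\le m$ is an envy-free pricing if $x_i\in D_i(p)$ for all $i$. Discrete domain: valuations, reports and budgets lie in $\mathbb{V}=\{k\epsilon: k\in\mathbb{N}\}$ for some fixed $\epsilon>0$, and prices are chosen from $\mathbb{W}=\{k\delta:k\in\mathbb{N}\}$ for some fixed $\delta>0$. Mechanism: an envy-free pricing mechanism $A$ maps each market (reported valuations, known budgets $\mathbf{B}$, known $m$) to an envy-free pricing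 $(\mathbf{x},p)$ with respect to the reported valuations. A strategy of buyer $i$ is a reported valuation $s_i\in\mathbb{V}$. Buyer $i$'s utility at a profile $\mathbf{s}$ is computed with its true valuation $v_i$ and the outcome of $A$ on $\mathbf{s}$. Truth-telling is the profile $\mathbf{s}=\mathbf{v}$. A profile is a pure Nash equilibrium if no buyer can strictly improve its utility by changing its own report. Best response dynamic: starting from an initial profile, at each step some buyer (in arbitrary order) who can strictly improve its utility changes its report to one maximizing its utility given the current reports of the others; it stops when no buyer can strictly improve. Objectives: the social welfare of an outcome is $\sum_i v_ix_i$ (with true valuations) and its revenue is $\sum_i x_ip$. The optimal revenue $\mathcal{REV}(\mathcal{M})$ is the maximum revenue of any envy-free pricing $(\mathbf{x},p)$ for $\mathcal{M}$ (with valuations $\mathbf{v}$). $A$ has approximation ratio $\beta$ for the optimal revenue if on every market its revenue is at least $\beta$ times the maximum revenue of any envy-free pricing on that market. The budget share of $\mathcal{M}$ is $\alpha=\max_{i\in N}B_i/\mathcal{REV}(\mathcal{M})$.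
   Formalization: In (i) the loss in social welfare is measured against the welfare at truth-telling, not the maximum possible; against the maximum it fails for a mechanism that always prices above all reports and sells nothing. The optimal revenue ranges over prices in W. *)

theory Defs
  imports "HOL-Library.Extended_Real"
begin

text \<open>
  A market with \<open>n\<close> buyers is given by two lists of length \<open>n\<close> and the number of units; buyer
  \<open>i\<close> is index \<open>i < n\<close>. An outcome is an allocation together with a unit price.
\<close>

record market =
  valuations :: "real list"
  budgets :: "real list"
  units :: nat

type_synonym outcome = "nat list \<times> real"
type_synonym mechanism = "market \<Rightarrow> outcome"

abbreviation buyers :: "market \<Rightarrow> nat set" where
  "buyers M \<equiv> {..<length (valuations M)}"

text \<open>The grid contains \<open>0\<close>, so zero reports and a zero price are possible.\<close>

definition grid :: "real \<Rightarrow> real set" where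
  "grid e = {real k * e | k :: nat. True}"

definition is_market :: "real \<Rightarrow> market \<Rightarrow> bool" where
  "is_market e M \<longleftrightarrow>
     valuations M \<noteq> [] \<and> length (budgets M) = length (valuations M) \<and>
     set (valuations M) \<subseteq> grid e \<and> set (budgets M) \<subseteq> grid e \<and> (\<forall>b \<in> set (budgets M). b > 0)"

text \<open>
  The largest number of units affordable at price \<open>p\<close>, capped by the supply. At \<open>p = 0\<close> the
  quotient \<open>b / p\<close> is meant to be infinite, whereas division by zero yields \<open>0\<close> in HOL.
\<close>

definition max_units :: "real \<Rightarrow> nat \<Rightarrow> real \<Rightarrow> nat" where
  "max_units b m p = (if p = 0 then m else min (nat \<lfloor>b / p\<rfloor>) m)"

definition demand :: "real \<Rightarrow> real \<Rightarrow> nat \<Rightarrow> real \<Rightarrow> nat set" where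
  "demand v b m p =
     (if v > p then {max_units b m p} else if v = p then {0..max_units b m p} else {0})"

definition utility :: "real \<Rightarrow> real \<Rightarrow> real \<Rightarrow> nat \<Rightarrow> ereal" where
  "utility v b p k = (if p * real k \<le> b then ereal (v * real k - p * real k) else - \<infinity>)"

text \<open>Envy-free pricings of the discrete domain: prices come from the grid of step \<open>d\<close>.\<close>

definition envy_free_pricing :: "real \<Rightarrow> market \<Rightarrow> outcome \<Rightarrow> bool" where
  "envy_free_pricing d M = (\<lambda>(x, p).
     length x = length (valuations M) \<and> sum_list x \<le> units M \<and> p \<in> grid d \<and>
     (\<forall>i \<in> buyers M. x ! i \<in> demand (valuations M ! i) (budgets M ! i) (units M) p))"

definition efp_mechanism :: "real \<Rightarrow> real \<Rightarrow> mechanism \<Rightarrow> bool" where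
  "efp_mechanism e d A \<longleftrightarrow> (\<forall>M. is_market e M \<longrightarrow> envy_free_pricing d M (A M))"

definition social_welfare :: "market \<Rightarrow> outcome \<Rightarrow> real" where
  "social_welfare M = (\<lambda>(x, p). \<Sum>i \<in> buyers M. valuations M ! i * real (x ! i))"

definition revenue :: "outcome \<Rightarrow> real" where
  "revenue = (\<lambda>(x, p). \<Sum>i<length x. real (x ! i) * p)"

definition max_budget :: "market \<Rightarrow> real" where
  "max_budget M = Max (set (budgets M))"

definition opt_revenue :: "real \<Rightarrow> market \<Rightarrow> real" where
  "opt_revenue d M = Max (revenue ` {out. envy_free_pricing d M out})"

definition budget_share :: "real \<Rightarrow> market \<Rightarrow> real" where
  "budget_share d M = max_budget M / opt_revenue d M"

definition revenue_approx_ratio :: "real \<Rightarrow> real \<Rightarrow> mechanism \<Rightarrow> real \<Rightarrow> bool" where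
  "revenue_approx_ratio e d A \<beta> \<longleftrightarrow>
     (\<forall>M. is_market e M \<longrightarrow> revenue (A M) \<ge> \<beta> * opt_revenue d M)"

text \<open>
  In the definitions below \<open>M\<close> is the true market and \<open>s\<close> a profile of reports: the outcome is that
  of the mechanism on the reported market, while utilities refer to the true valuations.
\<close>

definition outcome_at :: "mechanism \<Rightarrow> market \<Rightarrow> real list \<Rightarrow> outcome" where
  "outcome_at A M s = A (M\<lparr>valuations := s\<rparr>)"

definition utility_at :: "mechanism \<Rightarrow> market \<Rightarrow> real list \<Rightarrow> nat \<Rightarrow> ereal" where
  "utility_at A M s i = (case outcome_at A M s of (x, p) \<Rightarrow>
     utility (valuations M ! i) (budgets M ! i) p (x ! i))"

definition pure_nash :: "real \<Rightarrow> mechanism \<Rightarrow> market \<Rightarrow> real list \<Rightarrow> bool" where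
  "pure_nash e A M s \<longleftrightarrow>
     (\<forall>i \<in> buyers M. \<forall>r \<in> grid e. \<not> utility_at A M (s[i := r]) i > utility_at A M s i)"

definition best_response_step :: "real \<Rightarrow> mechanism \<Rightarrow> market \<Rightarrow> real list \<Rightarrow> real list \<Rightarrow> bool" where
  "best_response_step e A M s s' \<longleftrightarrow>
     (\<exists>i \<in> buyers M. \<exists>r \<in> grid e. s' = s[i := r] \<and>
        utility_at A M s' i > utility_at A M s i \<and>
        (\<forall>r' \<in> grid e. utility_at A M (s[i := r']) i \<le> utility_at A M s' i))"

text \<open>The profiles visited by some run of the best response dynamic, with any order of moves.\<close>

definition reachable_profile :: "real \<Rightarrow> mechanism \<Rightarrow> market \<Rightarrow> real list \<Rightarrow> real list \<Rightarrow> bool" where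
  "reachable_profile e A M s\<^sub>0 s \<longleftrightarrow> (best_response_step e A M)\<^sup>*\<^sup>* s\<^sub>0 s"

text \<open>
  Every run is finite and can only get stuck in a pure Nash equilibrium. The second conjunct says
  that an improving buyer has a utility-maximising report to move to.
\<close>

definition dynamic_converges :: "real \<Rightarrow> mechanism \<Rightarrow> market \<Rightarrow> real list \<Rightarrow> bool" where
  "dynamic_converges e A M s\<^sub>0 \<longleftrightarrow>
     (\<nexists>f :: nat \<Rightarrow> real list. f 0 = s\<^sub>0 \<and> (\<forall>k. best_response_step e A M (f k) (f (Suc k)))) \<and>
     (\<forall>s. reachable_profile e A M s\<^sub>0 s \<longrightarrow>
        pure_nash e A M s \<or> (\<exists>s'. best_response_step e A M s s'))"

text \<open>The maximum in the definition of the optimal revenue is taken over a finite nonempty set.\<close>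

lemma efp_revenues_finite:
  assumes "d > 0"
  shows "finite (revenue ` {out. envy_free_pricing d M out})"
proof -
  define K where "K = Max (insert 0 ((\<lambda>v. nat \<lceil>v / d\<rceil>) ` set (valuations M)))"
  define X where "X = {x :: nat list. set x \<subseteq> {..units M} \<and> length x = length (valuations M)}"
  define P where "P = (\<lambda>k. real k * d) ` {..K}"
  have fin: "finite (insert 0 (revenue ` (X \<times> P)))"
    unfolding X_def P_def by (auto intro!: finite_imageI finite_cartesian_product finite_lists_length_eq)
  have "revenue out \<in> insert 0 (revenue ` (X \<times> P))" if efp: "envy_free_pricing d M out" for out
  proof -
    obtain x p where out: "out = (x, p)" by fastforce
    from efp have len: "length x = length (valuations M)" and sum: "sum_list x \<le> units M"
      and p: "p \<in> grid d"
      and dem: "\<And>i. i \<in> buyers M \<Longrightarrow>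
         x ! i \<in> demand (valuations M ! i) (budgets M ! i) (units M) p"
      by (auto simp: envy_free_pricing_def out)
    have xX: "x \<in> X"
      using len sum member_le_sum_list[of _ x] unfolding X_def by (fastforce dest: order_trans)
    from p obtain k where k: "p = real k * d" by (auto simp: grid_def)
    show ?thesis
    proof (cases "\<exists>i \<in> buyers M. x ! i \<noteq> 0")
      case True
      then obtain i where i: "i < length (valuations M)" "x ! i \<noteq> 0" by auto
      with dem[of i] have "p \<le> valuations M ! i"
        by (auto simp: demand_def split: if_splits)
      hence "real k \<le> valuations M ! i / d"
        using assms k by (simp add: field_simps)
      hence "k \<le> nat \<lceil>valuations M ! i / d\<rceil>" by linarith
      also have "\<dots> \<le> K"
        unfolding K_def using i by (intro Max_ge) auto
      finally show ?thesis using xX k by (auto simp: out P_def)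
    next
      case False
      hence "revenue out = 0" by (auto simp: out revenue_def len)
      thus ?thesis by simp
    qed
  qed
  thus ?thesis by (intro finite_subset[OF _ fin]) auto
qed

lemma efp_exists:
  assumes "d > 0"
  shows "\<exists>out. envy_free_pricing d M out"
proof -
  define K where "K = Max (insert 0 ((\<lambda>v. nat \<lceil>v / d\<rceil>) ` set (valuations M)))"
  define p where "p = real (Suc K) * d"
  have "v < p" if "v \<in> set (valuations M)" for v
  proof -
    have "nat \<lceil>v / d\<rceil> \<le> K"
      unfolding K_def using that by (intro Max_ge) auto
    hence "v / d < real (Suc K)" by linarith
    thus ?thesis using assms by (simp add: p_def field_simps)
  qed
  hence "\<not> valuations M ! i > p \<and> valuations M ! i \<noteq> p" if "i < length (valuations M)" for i
    using that by (metis nth_mem less_asym less_irrefl)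
  moreover have "p \<in> grid d" unfolding grid_def p_def by blast
  ultimately have "envy_free_pricing d M (replicate (length (valuations M)) 0, p)"
    by (auto simp: envy_free_pricing_def demand_def sum_list_replicate)
  thus ?thesis by blast
qed

end

theory Submission
  imports Defs
begin

text \<open>
  A buyer receiving a bundle demanded at the posted price has the best payoff possible at that price,
  and this payoff does not increase with the price. So a buyer can gain by a deviation only if the
  price strictly falls. By induction along the dynamic, every buyer except the last mover \<open>l\<close> always
  has the best payoff at the current price: an earlier mover reported at least a price that has
  since strictly fallen. Hence every step is made by such a buyer, the price falls in every step,
  and the dynamic stops.

  Let \<open>x\<^sub>0, p\<^sub>0\<close> be the truthful outcome and \<open>x, p\<close> with \<open>p < p\<^sub>0\<close> a later one. Buyers other than \<open>l\<close>
  do not lose units. As \<open>l\<close> prefers the later outcome, it loses welfare at most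
  \<open>p\<^sub>0 x\<^sub>0\<^sub>l - p x\<^sub>l \<le> B\<^sub>l\<close>. It holds a unit, so no other buyer hits the supply cap, and any other buyer
  with \<open>x\<^sub>0\<^sub>i > 0\<close> pays \<open>\<lfloor>B\<^sub>i / p\<rfloor> p \<ge> B\<^sub>i / 2\<close>; together these are at least half of the truthful
  revenue without the contribution of \<open>l\<close>.
\<close>

section \<open>Affordable units and payoffs of a single buyer at a given price\<close>

lemma grid_nonneg: "d > 0 \<Longrightarrow> p \<in> grid d \<Longrightarrow> p \<ge> 0"
  by (auto simp: grid_def)

lemma max_units_le: "max_units b m p \<le> m"
  by (simp add: max_units_def)

lemma max_units_affordable:
  assumes "p \<ge> 0" "b > 0"
  shows "p * real (max_units b m p) \<le> b"
proof (cases "p = 0")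
  case False
  have "real (max_units b m p) \<le> real (nat \<lfloor>b / p\<rfloor>)"
    using False by (simp add: max_units_def)
  also have "\<dots> \<le> b / p" using assms by simp
  finally show ?thesis using False assms by (simp add: field_simps)
qed (use assms in simp)

lemma max_units_antimono:
  assumes "0 \<le> p" "p \<le> q" "b > 0"
  shows "max_units b m q \<le> max_units b m p"
proof (cases "p = 0")
  case False
  hence "b / q \<le> b / p" using assms by (simp add: frac_le)
  hence "nat \<lfloor>b / q\<rfloor> \<le> nat \<lfloor>b / p\<rfloor>" by (intro nat_mono floor_mono)
  thus ?thesis using False assms by (auto simp: max_units_def)
qed (simp add: max_units_le max_units_def)

text \<open>Below the supply cap the bundle is the integer part \<open>k\<close> of
  \<open>b / p\<close>. As at least one unit is affordable,
  \<open>b / p < k + 1 \<le> 2 * k\<close>.\<close>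

lemma max_units_spends_half:
  assumes "0 \<le> p" "p \<le> b" "0 < b" "max_units b m p < m"
  shows "b \<le> 2 * (p * real (max_units b m p))"
proof -
  \<comment> \<open>At price 0 \<open>max_units\<close> is the whole supply \<open>m\<close>, which
    the last assumption excludes.\<close>
  have p: "p > 0" using assms by (auto simp: max_units_def split: if_splits)
  define k where "k = nat \<lfloor>b / p\<rfloor>"
  have k: "max_units b m p = k"
    using assms p by (auto simp: max_units_def k_def min_def split: if_splits)
  have "1 \<le> b / p" using p assms by simp
  moreover from this have "b / p < real k + 1" unfolding k_def by linarith
  moreover have "1 \<le> k"
    unfolding k_def using \<open>1 \<le> b / p\<close> by (intro le_nat_floor) simp
  ultimately have "b / p \<le> 2 * real k" by linarith
  thus ?thesis using p unfolding k by (simp add: field_simps)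
qed

lemma demand_le_max_units: "k \<in> demand v b m p \<Longrightarrow> k \<le> max_units b m p"
  by (auto simp: demand_def split: if_splits)

text \<open>The maximum of \<open>(v - p) * k\<close> over all \<open>k\<close> up to
  \<open>max_units b m p\<close>, attained at the full bundle if \<open>v > p\<close> and at the
  empty one otherwise.\<close>

definition best_payoff :: "real \<Rightarrow> real \<Rightarrow> nat \<Rightarrow> real \<Rightarrow> real" where
  "best_payoff v b m p = max 0 (v - p) * real (max_units b m p)"

lemma best_payoff_nonneg: "best_payoff v b m p \<ge> 0"
  by (simp add: best_payoff_def)

lemma payoff_le_best:
  assumes "k \<le> max_units b m p"
  shows "(v - p) * real k \<le> best_payoff v b m p"
  unfolding best_payoff_def using assms by (intro mult_mono) auto

lemma payoff_demand: "k \<in> demand v b m p \<Longrightarrow> (v - p) * real k = best_payoff v b m p"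
  by (auto simp: demand_def best_payoff_def split: if_splits)

text \<open>A misreport does no harm while report and valuation both exceed the price: each of them
  then demands exactly the full bundle.\<close>

lemma payoff_demand_below:
  "k \<in> demand s b m p \<Longrightarrow> p < s \<Longrightarrow> p < v \<Longrightarrow> (v - p) * real k = best_payoff v b m p"
  by (auto simp: demand_def best_payoff_def)

lemma best_payoff_antimono:
  assumes "0 \<le> p" "p \<le> q" "b > 0"
  shows "best_payoff v b m q \<le> best_payoff v b m p"
  unfolding best_payoff_def using assms max_units_antimono[OF assms]
  by (intro mult_mono) auto

lemma revenue_eq: "revenue out = (\<Sum>i<length (fst out). real (fst out ! i) * snd out)"
  by (simp add: revenue_def case_prod_beta)

section \<open>Outcomes and payoffs at a profile of reports\<close>

locale market_dynamic =
  fixes e d :: real and A :: mechanism and M :: market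
  assumes e_pos: "e > 0" and d_pos: "d > 0"
    and mech: "efp_mechanism e d A" and market: "is_market e M"
begin

abbreviation truth :: "real list" where "truth \<equiv> valuations M"
abbreviation val :: "nat \<Rightarrow> real" where "val i \<equiv> valuations M ! i"
abbreviation budget :: "nat \<Rightarrow> real" where "budget i \<equiv> budgets M ! i"

definition alloc :: "real list \<Rightarrow> nat \<Rightarrow> nat" where "alloc s i = fst (outcome_at A M s) ! i"
definition price :: "real list \<Rightarrow> real" where "price s = snd (outcome_at A M s)"
definition payoff :: "real list \<Rightarrow> nat \<Rightarrow> real" where
  "payoff s i = (val i - price s) * real (alloc s i)"

definition profile :: "real list \<Rightarrow> bool" where
  "profile s \<longleftrightarrow> length s = length (valuations M) \<and> set s \<subseteq> grid e"

lemma budget_pos: "i \<in> buyers M \<Longrightarrow> budget i > 0"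
  using market by (auto simp: is_market_def)

lemma budget_le_max: "i \<in> buyers M \<Longrightarrow> budget i \<le> max_budget M"
  using market by (auto simp: is_market_def max_budget_def)

lemma val_nonneg: "i \<in> buyers M \<Longrightarrow> val i \<ge> 0"
  using market grid_nonneg[OF e_pos] by (metis is_market_def lessThan_iff nth_mem subsetD)

lemma max_budget_nonneg: "max_budget M \<ge> 0"
proof -
  have "0 \<in> buyers M" using market by (auto simp: is_market_def)
  thus ?thesis using budget_pos budget_le_max by fastforce
qed

lemma profile_truth: "profile (valuations M)"
  using market by (simp add: profile_def is_market_def)

lemma profile_update: "profile s \<Longrightarrow> r \<in> grid e \<Longrightarrow> profile (s[i := r])"
  unfolding profile_def by (auto dest!: set_update_subset_insert[THEN subsetD])

lemma envy_free_at:
  assumes "profile s"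
  shows "envy_free_pricing d (M\<lparr>valuations := s\<rparr>) (outcome_at A M s)"
proof -
  have "is_market e (M\<lparr>valuations := s\<rparr>)"
    using market assms by (auto simp: is_market_def profile_def)
  thus ?thesis using mech by (simp add: efp_mechanism_def outcome_at_def)
qed

lemma
  assumes "profile s"
  shows length_alloc: "length (fst (outcome_at A M s)) = length (valuations M)"
    and sum_alloc: "(\<Sum>i\<in>buyers M. alloc s i) \<le> units M"
    and price_grid: "price s \<in> grid d"
    and alloc_demand: "i \<in> buyers M \<Longrightarrow> alloc s i \<in> demand (s ! i) (budget i) (units M) (price s)"
  using envy_free_at[OF assms] assms
  by (auto simp: envy_free_pricing_def price_def alloc_def profile_def case_prod_beta
      sum_list_sum_nth atLeast0LessThan)

lemma price_nonneg: "profile s \<Longrightarrow> price s \<ge> 0"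
  using price_grid grid_nonneg[OF d_pos] by blast

lemma alloc_le: "profile s \<Longrightarrow> i \<in> buyers M \<Longrightarrow> alloc s i \<le> max_units (budget i) (units M) (price s)"
  using alloc_demand demand_le_max_units by blast

lemma alloc_affordable:
  assumes "profile s" "i \<in> buyers M"
  shows "price s * real (alloc s i) \<le> budget i"
proof -
  have "price s * real (alloc s i) \<le> price s * real (max_units (budget i) (units M) (price s))"
    using alloc_le[OF assms] price_nonneg[OF assms(1)] by (intro mult_left_mono) auto
  also have "\<dots> \<le> budget i"
    using price_nonneg[OF assms(1)] budget_pos[OF assms(2)] by (rule max_units_affordable)
  finally show ?thesis .
qed

text \<open>Budgets are known to the mechanism, so an envy-free bundle is affordable whatever is
  reported and the value \<open>- \<infinity>\<close> never occurs.\<close>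

lemma utility_at_eq_payoff:
  assumes "profile s" "i \<in> buyers M"
  shows "utility_at A M s i = ereal (payoff s i)"
  using alloc_affordable[OF assms]
  by (simp add: utility_at_def utility_def payoff_def price_def alloc_def case_prod_beta
      left_diff_distrib)

section \<open>Best payoffs and the invariant of the dynamic\<close>

lemma payoff_le_best_payoff:
  "profile s \<Longrightarrow> i \<in> buyers M \<Longrightarrow> payoff s i \<le> best_payoff (val i) (budget i) (units M) (price s)"
  unfolding payoff_def by (intro payoff_le_best alloc_le)

lemma payoff_pos:
  assumes "profile s" "i \<in> buyers M" "payoff s i > 0"
  shows "alloc s i > 0" "price s < val i" "price s \<le> s ! i"
proof -
  show "alloc s i > 0" using assms by (auto simp: payoff_def intro: gr0I)
  thus "price s < val i" using assms by (auto simp: payoff_def zero_less_mult_iff)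
  show "price s \<le> s ! i"
    using alloc_demand[OF assms(1,2)] \<open>alloc s i > 0\<close>
    by (auto simp: demand_def split: if_splits)
qed

text \<open>A condition on reports that ensures the best payoff at the current price and survives a
  fall of the price. The inequality for a misreport is strict because a report equal to the price
  may be served any smaller bundle.\<close>

definition settled :: "real list \<Rightarrow> nat \<Rightarrow> bool" where
  "settled s i \<longleftrightarrow> s ! i = val i \<or> (price s < s ! i \<and> price s < val i)"

lemma payoff_settled:
  assumes "profile s" "i \<in> buyers M" "settled s i"
  shows "payoff s i = best_payoff (val i) (budget i) (units M) (price s)"
  using assms alloc_demand[OF assms(1,2)] unfolding payoff_def settled_def
  by (metis payoff_demand payoff_demand_below)

lemma deviation_lowers_price:
  assumes "profile s" "profile s'" "i \<in> buyers M" "settled s i" "payoff s' i > payoff s i"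
  shows "price s' < price s"
proof (rule ccontr)
  assume "\<not> price s' < price s"
  hence "best_payoff (val i) (budget i) (units M) (price s')
      \<le> best_payoff (val i) (budget i) (units M) (price s)"
    using price_nonneg[OF assms(1)] budget_pos[OF assms(3)] by (intro best_payoff_antimono) auto
  thus False
    using payoff_le_best_payoff[OF assms(2,3)] payoff_settled[OF assms(1,3,4)] assms(5) by linarith
qed

text \<open>What is remembered after a move of \<open>l\<close>. Playing a best response keeps
  \<open>l\<close> from moving twice in a row; the gain over \<open>truth\<close> makes its payoff
  positive and later bounds its welfare loss.\<close>

definition last_mover :: "real list \<Rightarrow> nat \<Rightarrow> bool" where
  "last_mover s l \<longleftrightarrow> l \<in> buyers M \<and> price s < price truth \<and> payoff s l > payoff truth l \<and>
     (\<forall>r \<in> grid e. payoff (s[l := r]) l \<le> payoff s l) \<and>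
     (\<forall>i \<in> buyers M. i \<noteq> l \<longrightarrow> settled s i)"

definition on_path :: "real list \<Rightarrow> bool" where
  "on_path s \<longleftrightarrow> profile s \<and> (s = truth \<or> (\<exists>l. last_mover s l))"

lemma payoff_truth:
  "i \<in> buyers M \<Longrightarrow>
     payoff truth i = best_payoff (val i) (budget i) (units M) (price truth)"
  by (rule payoff_settled) (simp_all add: profile_truth settled_def)

lemma payoff_truth_nonneg: "i \<in> buyers M \<Longrightarrow> payoff truth i \<ge> 0"
  using payoff_truth best_payoff_nonneg by metis

lemma last_mover_payoff_pos: "last_mover s l \<Longrightarrow> payoff s l > 0"
  using payoff_truth_nonneg[of l] by (auto simp: last_mover_def)

lemma step_iff_payoff:
  assumes "profile s"
  shows "best_response_step e A M s s' \<longleftrightarrow>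
     (\<exists>i \<in> buyers M. \<exists>r \<in> grid e. s' = s[i := r] \<and> payoff s' i > payoff s i \<and>
        (\<forall>r' \<in> grid e. payoff (s[i := r']) i \<le> payoff s' i))"
  unfolding best_response_step_def
  using assms by (intro bex_cong refl conj_cong ball_cong)
    (auto simp: utility_at_eq_payoff profile_update)

lemma pure_nash_iff_payoff:
  assumes "profile s"
  shows "pure_nash e A M s \<longleftrightarrow>
     (\<forall>i \<in> buyers M. \<forall>r \<in> grid e. payoff (s[i := r]) i \<le> payoff s i)"
  unfolding pure_nash_def
  using assms by (intro ball_cong refl) (auto simp: utility_at_eq_payoff profile_update not_less)

lemma step_on_path:
  assumes "on_path s" "best_response_step e A M s s'"
  shows "on_path s' \<and> price s' < price s"
proof -
  have s: "profile s" using assms(1) by (simp add: on_path_def)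
  obtain i r where i: "i \<in> buyers M" and r: "r \<in> grid e" and s'_eq: "s' = s[i := r]"
    and gain: "payoff s' i > payoff s i"
    and best: "\<forall>r' \<in> grid e. payoff (s[i := r']) i \<le> payoff s' i"
    using assms(2) unfolding step_iff_payoff[OF s] by blast
  have s': "profile s'" unfolding s'_eq using s r by (rule profile_update)
  \<comment> \<open>At \<open>truth\<close> every buyer is settled. Later the improving buyer
    differs from the last mover, which already plays a best response.\<close>
  have settled_i: "settled s i"
    using assms(1) i r gain unfolding on_path_def last_mover_def s'_eq settled_def
    by (metis not_less)
  have less: "price s' < price s"
    using s s' i settled_i gain by (rule deviation_lowers_price)
  have le_truth: "price s \<le> price truth"
    using assms(1) by (auto simp: on_path_def last_mover_def)
  \<comment> \<open>Both sides are best payoffs, the right one at a price that is no higher, so the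
    gain over \<open>s\<close> is also one over \<open>truth\<close>.\<close>
  have "payoff truth i \<le> payoff s i"
    unfolding payoff_truth[OF i] payoff_settled[OF s i settled_i]
    using price_nonneg[OF s] le_truth budget_pos[OF i] by (rule best_payoff_antimono)
  moreover have "settled s' j" if j: "j \<in> buyers M" "j \<noteq> i" for j
  proof (cases "settled s j")
    case True
    thus ?thesis using j less by (auto simp: settled_def s'_eq)
  next
    case False
    \<comment> \<open>Only the previous mover can be unsettled. Its positive payoff puts report and
      valuation at or above \<open>price s\<close>, hence strictly above the new price.\<close>
    hence "last_mover s j"
      using assms(1) j unfolding on_path_def last_mover_def settled_def by metis
    hence "payoff s j > 0" by (rule last_mover_payoff_pos)
    thus ?thesis using payoff_pos[OF s j(1)] j less by (auto simp: settled_def s'_eq)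
  qed
  ultimately have "last_mover s' i"
    using i gain less le_truth best by (auto simp: last_mover_def s'_eq)
  thus ?thesis using s' less by (auto simp: on_path_def)
qed

lemma reachable_on_path:
  assumes "reachable_profile e A M truth s"
  shows "on_path s"
  using assms unfolding reachable_profile_def
proof induction
  case base
  show ?case by (simp add: on_path_def profile_truth)
next
  case (step s s')
  thus ?case using step_on_path by blast
qed

text \<open>Serves to show that any improving deviation yields a positive payoff, hence a price
  below the deviator's valuation.\<close>

lemma on_path_payoff_nonneg:
  assumes "on_path s" "i \<in> buyers M"
  shows "payoff s i \<ge> 0"
proof (cases "settled s i")
  case True
  thus ?thesis using assms payoff_settled best_payoff_nonneg by (metis on_path_def)
next
  case False
  hence "last_mover s i"
    using assms unfolding on_path_def last_mover_def settled_def by metis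
  thus ?thesis using last_mover_payoff_pos by force
qed

section \<open>Convergence of the dynamic\<close>

lemma no_infinite_run:
  "\<nexists>f :: nat \<Rightarrow> real list. f 0 = truth \<and> (\<forall>k. best_response_step e A M (f k) (f (Suc k)))"
proof
  assume "\<exists>f :: nat \<Rightarrow> real list. f 0 = truth \<and> (\<forall>k. best_response_step e A M (f k) (f (Suc k)))"
  then obtain f :: "nat \<Rightarrow> real list" where f0: "f 0 = truth"
    and step: "\<And>k. best_response_step e A M (f k) (f (Suc k))" by blast
  have path: "on_path (f k)" for k
  proof (induction k)
    case 0
    show ?case by (simp add: on_path_def profile_truth f0)
  next
    case (Suc k)
    thus ?case using step step_on_path by blast
  qed
  \<comment> \<open>On the price grid, ever falling prices would give an infinite descent of natural
    numbers.\<close>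
  have "\<exists>n. price (f k) = real n * d" for k
    using path[of k] price_grid[of "f k"] by (auto simp: on_path_def grid_def)
  then obtain g where g: "\<And>k. price (f k) = real (g k) * d" by metis
  have "g (Suc k) < g k" for k
    using step_on_path[OF path step, of k] d_pos by (simp add: g)
  hence "\<forall>k. (g (Suc k), g k) \<in> less_than" by simp
  moreover have "\<nexists>h :: nat \<Rightarrow> nat. \<forall>k. (h (Suc k), h k) \<in> less_than"
    using wf_less_than unfolding wf_iff_no_infinite_down_chain by blast
  ultimately show False by blast
qed

text \<open>There are infinitely many reports, but the improving ones lead to finitely many payoffs:
  the price is a grid point below \<open>val i\<close> and the bundle has at most
  \<open>units M\<close> units. So a maximum is attained.\<close>

lemma best_response_exists:
  assumes "on_path s" "\<not> pure_nash e A M s"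
  shows "\<exists>s'. best_response_step e A M s s'"
proof -
  have s: "profile s" using assms(1) by (simp add: on_path_def)
  obtain i r0 where i: "i \<in> buyers M" and r0: "r0 \<in> grid e" "payoff (s[i := r0]) i > payoff s i"
    using assms(2) unfolding pure_nash_iff_payoff[OF s] by (auto simp: not_le)
  define R where "R = {r \<in> grid e. payoff (s[i := r]) i > payoff s i}"
  define U where "U = (\<lambda>r. payoff (s[i := r]) i) ` R"
  define K where "K = nat \<lceil>val i / d\<rceil>"
  have "U \<subseteq> (\<lambda>(k, x). (val i - real k * d) * real x) ` ({..K} \<times> {..units M})"
  proof
    fix u assume "u \<in> U"
    then obtain r where r: "r \<in> grid e" "payoff (s[i := r]) i > payoff s i"
      and u: "u = payoff (s[i := r]) i" by (auto simp: U_def R_def)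
    let ?s = "s[i := r]"
    have s': "profile ?s" using s r(1) by (rule profile_update)
    obtain k where k: "price ?s = real k * d" using price_grid[OF s'] by (auto simp: grid_def)
    have "payoff ?s i > 0" using r(2) on_path_payoff_nonneg[OF assms(1) i] by linarith
    hence "real k * d < val i" using payoff_pos(2)[OF s' i] k by simp
    hence "real k < val i / d" using d_pos by (simp add: field_simps)
    hence "k \<le> K" unfolding K_def by linarith
    moreover have "alloc ?s i \<le> units M"
      using alloc_le[OF s' i] max_units_le order_trans by blast
    ultimately show "u \<in> (\<lambda>(k, x). (val i - real k * d) * real x) ` ({..K} \<times> {..units M})"
      by (auto simp: u payoff_def k intro!: image_eqI[where x = "(k, alloc ?s i)"])
  qed
  hence fin: "finite U" by (rule finite_subset) simp
  have "U \<noteq> {}" using r0 by (auto simp: U_def R_def)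
  with fin have "Max U \<in> U" by (rule Max_in)
  then obtain r where r: "r \<in> grid e" "payoff (s[i := r]) i > payoff s i"
    and max: "payoff (s[i := r]) i = Max U" by (auto simp: U_def R_def)
  have "payoff (s[i := r']) i \<le> payoff (s[i := r]) i" if "r' \<in> grid e" for r'
  proof (cases "r' \<in> R")
    case True
    thus ?thesis unfolding max using fin by (intro Max_ge) (auto simp: U_def)
  next
    case False
    thus ?thesis using that r(2) by (auto simp: R_def)
  qed
  hence "best_response_step e A M s (s[i := r])"
    unfolding step_iff_payoff[OF s] using i r by blast
  thus ?thesis ..
qed

lemma converges: "dynamic_converges e A M truth"
  unfolding dynamic_converges_def
  using no_infinite_run reachable_on_path best_response_exists by blast

section \<open>Welfare and revenue at the profiles reached\<close>

lemma alloc_settled_ge: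
  assumes "profile s" "i \<in> buyers M" "settled s i" "price s < price truth"
  shows "alloc truth i \<le> alloc s i"
    and "alloc truth i > 0 \<Longrightarrow> alloc s i = max_units (budget i) (units M) (price s)"
proof -
  have eq: "alloc s i = max_units (budget i) (units M) (price s)" if pos: "alloc truth i > 0"
  proof -
    \<comment> \<open>A unit bought at \<open>truth\<close> puts \<open>val i\<close> above
      \<open>price s\<close>. Either case of \<open>settled\<close> then puts the report above it
      too, where only the full bundle is demanded.\<close>
    have "price truth \<le> val i"
      using alloc_demand[OF profile_truth assms(2)] pos by (auto simp: demand_def split: if_splits)
    thus ?thesis
      using alloc_demand[OF assms(1,2)] assms(3,4) by (auto simp: settled_def demand_def)
  qed
  thus "alloc truth i > 0 \<Longrightarrow> alloc s i = max_units (budget i) (units M) (price s)" .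
  show "alloc truth i \<le> alloc s i"
  proof (cases "alloc truth i = 0")
    case False
    have "alloc truth i \<le> max_units (budget i) (units M) (price truth)"
      using profile_truth assms(2) by (rule alloc_le)
    also have "\<dots> \<le> max_units (budget i) (units M) (price s)"
      using price_nonneg[OF assms(1)] assms(4) budget_pos[OF assms(2)]
      by (intro max_units_antimono) auto
    finally show ?thesis using eq False by simp
  qed simp
qed

lemma social_welfare_eq:
  "social_welfare M (outcome_at A M s) = (\<Sum>i\<in>buyers M. val i * real (alloc s i))"
  by (simp add: social_welfare_def alloc_def case_prod_beta)

lemma revenue_at:
  "profile s \<Longrightarrow> revenue (outcome_at A M s) = (\<Sum>i\<in>buyers M. price s * real (alloc s i))"
  by (simp add: revenue_eq alloc_def price_def length_alloc mult.commute)

lemma revenue_nonneg: "profile s \<Longrightarrow> revenue (outcome_at A M s) \<ge> 0"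
  by (auto simp: revenue_at price_nonneg intro!: sum_nonneg mult_nonneg_nonneg)

lemma welfare_loss:
  assumes "on_path s"
  shows "social_welfare M (outcome_at A M truth) - social_welfare M (outcome_at A M s) \<le> max_budget M"
proof (cases "s = truth")
  case True
  thus ?thesis using max_budget_nonneg by simp
next
  case False
  then obtain l where s: "profile s" and mover: "last_mover s l"
    using assms by (auto simp: on_path_def)
  hence l: "l \<in> buyers M" and less: "price s < price truth" and gain: "payoff s l > payoff truth l"
    and others: "\<And>i. i \<in> buyers M \<Longrightarrow> i \<noteq> l \<Longrightarrow> settled s i"
    by (auto simp: last_mover_def)
  have "(\<Sum>i\<in>buyers M - {l}. val i * real (alloc truth i))
      \<le> (\<Sum>i\<in>buyers M - {l}. val i * real (alloc s i))"
    using alloc_settled_ge(1)[OF s _ _ less] others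
    by (intro sum_mono mult_left_mono val_nonneg) auto
  moreover have "val l * real (alloc truth l) - val l * real (alloc s l) \<le> max_budget M"
  proof -
    \<comment> \<open>The gain of \<open>l\<close> rearranged: the welfare it loses is bounded by
      the drop in its payment.\<close>
    have "val l * real (alloc truth l) - val l * real (alloc s l)
        \<le> price truth * real (alloc truth l) - price s * real (alloc s l)"
      using gain by (simp add: payoff_def left_diff_distrib)
    also have "\<dots> \<le> price truth * real (alloc truth l)"
      using price_nonneg[OF s] by simp
    also have "\<dots> \<le> max_budget M"
      using alloc_affordable[OF profile_truth l] budget_le_max[OF l] by linarith
    finally show ?thesis .
  qed
  ultimately show ?thesis
    unfolding social_welfare_eq using l by (simp add: sum.remove[of "buyers M" l])
qed

lemma payment_settled_ge_half:
  assumes s: "profile s" and i: "i \<in> buyers M" "settled s i" and less: "price s < price truth"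
    and l: "l \<in> buyers M" "l \<noteq> i" "alloc s l > 0"
  shows "price truth * real (alloc truth i) \<le> 2 * (price s * real (alloc s i))"
proof (cases "alloc truth i = 0")
  case True
  thus ?thesis using price_nonneg[OF s] by simp
next
  case False
  have units: "alloc s i = max_units (budget i) (units M) (price s)"
    using alloc_settled_ge(2)[OF s i less] False by simp
  have "alloc s i + alloc s l = (\<Sum>j\<in>{i, l}. alloc s j)" using l by simp
  also have "\<dots> \<le> (\<Sum>j\<in>buyers M. alloc s j)" using i l by (intro sum_mono2) auto
  also have "\<dots> \<le> units M" using s by (rule sum_alloc)
  finally have "alloc s i < units M" using l(3) by simp
  have paid: "price truth * real (alloc truth i) \<le> budget i"
    using profile_truth i(1) by (rule alloc_affordable)
  \<comment> \<open>Having paid for a unit at \<open>price truth\<close>, buyer \<open>i\<close> can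
    afford one at the lower \<open>price s\<close>, as the bound of one half requires.\<close>
  have "price truth * 1 \<le> price truth * real (alloc truth i)"
    using False price_nonneg[OF profile_truth] by (intro mult_left_mono) auto
  hence "price s \<le> budget i" using paid less by linarith
  hence "budget i \<le> 2 * (price s * real (alloc s i))"
    unfolding units using price_nonneg[OF s] budget_pos[OF i(1)] \<open>alloc s i < units M\<close>
    by (intro max_units_spends_half) (simp_all add: units)
  thus ?thesis using paid by linarith
qed

lemma revenue_loss:
  assumes "on_path s"
  shows "revenue (outcome_at A M truth) - max_budget M \<le> 2 * revenue (outcome_at A M s)"
proof (cases "s = truth")
  case True
  thus ?thesis using max_budget_nonneg revenue_nonneg[OF profile_truth] by simp
next
  case False
  then obtain l where s: "profile s" and mover: "last_mover s l"
    using assms by (auto simp: on_path_def)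
  hence l: "l \<in> buyers M" and less: "price s < price truth"
    and others: "\<And>i. i \<in> buyers M \<Longrightarrow> i \<noteq> l \<Longrightarrow> settled s i"
    by (auto simp: last_mover_def)
  have pos: "alloc s l > 0" using s l last_mover_payoff_pos[OF mover] by (rule payoff_pos)
  have "(\<Sum>i\<in>buyers M - {l}. price truth * real (alloc truth i))
      \<le> (\<Sum>i\<in>buyers M - {l}. 2 * (price s * real (alloc s i)))"
    using payment_settled_ge_half[OF s _ _ less l _ pos] others by (intro sum_mono) auto
  \<comment> \<open>The truthful payment of \<open>l\<close> is written off as one budget; of its
    later payment only the sign is used.\<close>
  moreover have "price truth * real (alloc truth l) \<le> max_budget M"
    using alloc_affordable[OF profile_truth l] budget_le_max[OF l] by linarith
  moreover have "0 \<le> price s * real (alloc s l)" using price_nonneg[OF s] by simp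
  ultimately show ?thesis
    unfolding revenue_at[OF s] revenue_at[OF profile_truth] using l
    by (simp add: sum.remove[of "buyers M" l] sum_distrib_left)
qed

lemma revenue_ratio:
  assumes "on_path s" "revenue_approx_ratio e d A \<beta>"
  shows "revenue (outcome_at A M s) \<ge> (\<beta> - budget_share d M) / 2 * opt_revenue d M"
proof (cases "opt_revenue d M = 0")
  \<comment> \<open>Here \<open>budget_share\<close> divides by zero, but the bound is 0 through its
    factor \<open>opt_revenue d M\<close>.\<close>
  case True
  thus ?thesis using assms(1) revenue_nonneg by (simp add: on_path_def)
next
  case False
  have "outcome_at A M truth = A M" by (simp add: outcome_at_def)
  hence "\<beta> * opt_revenue d M \<le> revenue (outcome_at A M truth)"
    using assms(2) market by (simp add: revenue_approx_ratio_def)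
  moreover have "budget_share d M * opt_revenue d M = max_budget M"
    using False by (simp add: budget_share_def)
  hence "(\<beta> - budget_share d M) / 2 * opt_revenue d M = (\<beta> * opt_revenue d M - max_budget M) / 2"
    by (simp add: algebra_simps diff_divide_distrib)
  ultimately show ?thesis using revenue_loss[OF assms(1)] by simp
qed

end

theorem theorem1p4:
  fixes \<epsilon> \<delta> \<beta> :: real and A :: mechanism and M :: market
  assumes "\<epsilon> > 0" and "\<delta> > 0"
    and "efp_mechanism \<epsilon> \<delta> A"
    and "0 \<le> \<beta>" and "\<beta> \<le> 1"
    and "revenue_approx_ratio \<epsilon> \<delta> A \<beta>"
    and "is_market \<epsilon> M"
  shows "dynamic_converges \<epsilon> A M (valuations M) \<and>
    (\<forall>s. reachable_profile \<epsilon> A M (valuations M) s \<and> pure_nash \<epsilon> A M s \<longrightarrow>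
       social_welfare M (outcome_at A M (valuations M)) - social_welfare M (outcome_at A M s)
         \<le> max_budget M \<and>
       revenue (outcome_at A M s) \<ge> (\<beta> - budget_share \<delta> M) / 2 * opt_revenue \<delta> M)"
proof -
  interpret market_dynamic \<epsilon> \<delta> A M
    using assms by unfold_locales
  show ?thesis
    using converges reachable_on_path welfare_loss revenue_ratio assms(6) by blast
qed

end
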